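(* Let $q$ be a power of a prime $p$ and let $d$ be a divisor of $q-1$ with $d>1$. Let $S_d=\{x^d: x\in\mathbb{F}_q^*\}$. If $A,B\subset\mathbb{F}_q$ satisfy $A+B\subset S_d\cup\{0\}$ and $$\binom{|A|-1+\frac{q-1}{d}}{\frac{q-1}{d}}\not\equiv 0 \pmod p,$$ then $$|A||B|\le \frac{q-1}{d}+|A\cap(-B)|.$$
   Context: $\mathbb{F}_q$ is the finite field with $q$ elements, of characteristic $p$. For sets $A,B\subset\mathbb{F}_q$, $A+B=\{a+b:a\in A,b\in B\}$ and $-B=\{-b:b\in B\}$. $S_d$ is the subgroup of $\mathbb{F}_q^*$ of order $\frac{q-1}{d}$. *)

theory Defs
  imports Complex_Main "HOL-Library.Set_Algebras" "HOL-Library.Cardinality"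
    "HOL-Number_Theory.Cong"
begin

text \<open>
  The finite field with \<open>q\<close> elements is a type of class \<open>{field, finite}\<close> of
  cardinality \<open>q\<close>. The sumset \<open>A + B\<close> is that of \<^theory>\<open>HOL-Library.Set_Algebras\<close>;
  the set of negatives is written \<open>uminus ` B\<close>, since \<open>- B\<close> is the complement of \<open>B\<close>.
\<close>

definition dth_powers :: "nat \<Rightarrow> 'a::field set" where
  "dth_powers d = {x ^ d | x. x \<noteq> 0}"

end

theory Submission
  imports Defs "HOL-Computational_Algebra.Polynomial"
begin

text \<open>
  This is Stepanov's method in the form of Hanson and Petridis. Let \<open>m = |A|\<close> and
  \<open>N = (q - 1) / d\<close>, and let \<open>c\<close> be the Lagrange weights of \<open>A\<close>, for which
  \<open>\<Sum>a\<in>A. c a * g a\<close> is the coefficient of \<open>x\<^bsup>m-1\<^esup>\<close> in \<open>g\<close> whenever \<open>deg g < m\<close>. The polynomial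
  \<open>f(x) = (\<Sum>a\<in>A. c a * (x + a)\<^bsup>m-1+N\<^esup>) - 1\<close> has degree exactly \<open>N\<close>: its higher coefficients
  vanish by the choice of \<open>c\<close>, and its coefficient at \<open>x\<^bsup>N\<^esup>\<close> is the binomial coefficient that is
  nonzero mod \<open>p\<close>. Since \<open>(a + b)\<^sup>N = 1\<close> unless \<open>a + b = 0\<close>, each \<open>b \<in> B\<close> is a root of \<open>f\<close>
  of order at least \<open>m\<close>, or at least \<open>m - 1\<close> if \<open>b \<in> -A\<close>. Now count roots.
\<close>

section \<open>Finite fields: order of elements and characteristic\<close>

lemma power_CARD_minus_1_eq_1:
  fixes x :: "'a::{field, finite}"
  assumes "x \<noteq> 0"
  shows "x ^ (CARD('a) - 1) = 1"
proof -
  have "(\<Prod>y\<in>UNIV-{0}. x * y) = (\<Prod>y\<in>UNIV-{0}. y)"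
    by (rule prod.reindex_bij_witness[of _ "\<lambda>y. y / x" "\<lambda>y. x * y"]) (use assms in auto)
  moreover have "(\<Prod>y\<in>UNIV-{0::'a}. y) \<noteq> 0"
    by simp
  ultimately show ?thesis
    by (simp add: prod.distrib card_Diff_subset)
qed

lemma CHAR_eq_of_CARD_prime_power:
  assumes "prime p" and "CARD('a::{field, finite}) = p ^ n"
  shows "CHAR('a) = p"
proof -
  have "CHAR('a) > 0"
    by (rule finite_imp_CHAR_pos) simp
  then have "prime CHAR('a)"
    by (rule prime_CHAR_semidom)
  moreover have "CHAR('a) dvd p ^ n"
  proof -
    \<comment> \<open>Translation by 1 permutes the field, so the added ones sum to zero.\<close>
    have "(\<Sum>x\<in>UNIV. x + 1) = (\<Sum>x\<in>UNIV. x :: 'a)"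
      by (rule sum.reindex_bij_witness[of _ "\<lambda>x. x - 1" "\<lambda>x. x + 1"]) auto
    then have "of_nat CARD('a) = (0 :: 'a)"
      by (simp add: sum.distrib)
    then show ?thesis
      by (metis assms(2) of_nat_eq_0_iff_char_dvd)
  qed
  ultimately show ?thesis
    using assms(1) by (metis prime_dvd_power primes_dvd_imp_eq)
qed

section \<open>Lagrange interpolation\<close>

definition lagrange_weight :: "'a::field set \<Rightarrow> 'a \<Rightarrow> 'a" where
  "lagrange_weight A x = inverse (\<Prod>y\<in>A-{x}. x - y)"

text \<open>A polynomial of degree below \<open>card A\<close> is its own interpolant on
  \<open>A\<close>. Each unnormalized basis polynomial is monic of degree \<open>card A - 1\<close>,
  so comparing coefficients there leaves only the weighted values of \<open>g\<close>.\<close>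

lemma sum_lagrange_weight:
  fixes A :: "'a::field set"
  assumes "finite A" and deg: "degree g < card A"
  shows "(\<Sum>x\<in>A. lagrange_weight A x * poly g x) = coeff g (card A - 1)"
proof -
  define L where "L = (\<lambda>x. \<Prod>y\<in>A-{x}. [:- y, 1:])"
  define h where "h = (\<Sum>x\<in>A. smult (lagrange_weight A x * poly g x) (L x))"
  have deg_L: "degree (L x) = card A - 1" if "x \<in> A" for x
    using that assms(1) by (simp add: L_def degree_prod_eq_sum_degree)
  have lead_L: "coeff (L x) (card A - 1) = 1" if "x \<in> A" for x
  proof -
    have "lead_coeff (L x) = 1"
      by (simp add: L_def lead_coeff_prod)
    then show ?thesis
      using that by (simp add: deg_L)
  qed
  have "h = g"
  proof (rule poly_eqI_degree[where A = A])
    fix z assume z: "z \<in> A"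
    have L0: "poly (L x) z = 0" if "x \<in> A - {z}" for x
      using that z assms(1) by (auto simp: L_def poly_prod)
    have Lz: "lagrange_weight A z * poly (L z) z = 1"
    proof -
      have "poly (L z) z = (\<Prod>y\<in>A-{z}. z - y)"
        by (simp add: L_def poly_prod)
      moreover have "(\<Prod>y\<in>A-{z}. z - y) \<noteq> 0"
        using assms(1) by auto
      ultimately show ?thesis
        by (simp add: lagrange_weight_def)
    qed
    have "poly h z = (\<Sum>x\<in>A. lagrange_weight A x * poly g x * poly (L x) z)"
      by (simp add: h_def poly_sum)
    also have "\<dots> = lagrange_weight A z * poly g z * poly (L z) z"
      using z assms(1) L0 by (simp add: sum.remove)
    also have "\<dots> = poly g z"
      using Lz by (simp add: mult.commute mult.left_commute)
    finally show "poly h z = poly g z" .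
  next
    have "degree h \<le> card A - 1"
      unfolding h_def using assms(1)
      by (intro degree_sum_le) (auto intro: order_trans[OF degree_smult_le] simp: deg_L)
    then show "degree h < card A"
      using deg by simp
  qed (fact deg)
  then have "coeff g (card A - 1) = coeff h (card A - 1)"
    by simp
  also have "\<dots> = (\<Sum>x\<in>A. lagrange_weight A x * poly g x)"
    unfolding h_def coeff_sum by (intro sum.cong) (simp_all only: coeff_smult lead_L mult_1_right)
  finally show ?thesis
    by simp
qed

section \<open>Recentring and orders of roots\<close>

lemma coeff_monic_linear_power:
  "coeff ([:a, 1:] ^ n) i = of_nat (n choose i) * (a::'a::idom) ^ (n - i)"
proof (cases "i \<le> n")
  case False
  then show ?thesis
    by (simp add: coeff_eq_0 degree_linear_power binomial_eq_0)
qed (simp add: coeff_linear_poly_power)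

lemma pcompose_power: "pcompose (p ^ k) q = pcompose p q ^ k"
  by (induction k) (simp_all add: pcompose_mult pcompose_1)

text \<open>Recentring moves the root \<open>b\<close> to 0, where its order is read off the low
  coefficients; iterated derivatives would bring in factorials that can vanish in characteristic
  \<open>p\<close>.\<close>

lemma linear_power_dvd_if_shifted_coeffs_0:
  fixes f :: "'a::idom poly"
  assumes "\<And>j. j < k \<Longrightarrow> coeff (pcompose f [:b, 1:]) j = 0"
  shows "[:- b, 1:] ^ k dvd f"
proof -
  have "monom 1 k dvd pcompose f [:b, 1:]"
    using assms by (simp add: monom_1_dvd_iff')
  then obtain h where "pcompose f [:b, 1:] = [:0, 1:] ^ k * h"
    by (auto simp: monom_altdef elim: dvdE)
  then have "pcompose (pcompose f [:b, 1:]) [:- b, 1:] = pcompose ([:0, 1:] ^ k * h) [:- b, 1:]"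
    by simp
  moreover have "pcompose ([:0, 1:] ^ k) [:- b, 1:] = [:- b, 1:] ^ k"
    by (simp add: pcompose_power pcompose_pCons)
  ultimately have "f = [:- b, 1:] ^ k * pcompose h [:- b, 1:]"
    by (simp add: pcompose_mult pcompose_assoc[symmetric] pcompose_pCons)
  then show ?thesis
    by (rule dvdI)
qed

lemma sum_order_on_le_degree:
  fixes f :: "'a::idom poly"
  assumes "f \<noteq> 0" and "finite B"
  shows "(\<Sum>b\<in>B. order b f) \<le> degree f"
proof -
  have "(\<Sum>b\<in>B. order b f) = (\<Sum>b\<in>{b\<in>B. poly f b = 0}. order b f)"
    using assms by (intro sum.mono_neutral_right) (auto simp: order_root)
  also have "\<dots> \<le> (\<Sum>b | poly f b = 0. order b f)"
    using assms by (intro sum_mono2 poly_roots_finite) auto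
  also have "\<dots> \<le> degree f"
    using assms(1) by (rule sum_order_le_degree)
  finally show ?thesis .
qed

section \<open>Degree and root orders of the Stepanov polynomial\<close>

definition stepanov_poly :: "'a::field set \<Rightarrow> nat \<Rightarrow> 'a poly" where
  "stepanov_poly A N =
    (\<Sum>a\<in>A. smult (lagrange_weight A a) ([:a, 1:] ^ (card A - 1 + N))) - 1"

text \<open>This serves twice: \<open>b = 0\<close> gives the degree, general \<open>b\<close> the
  order at \<open>b\<close>.\<close>

lemma coeff_pcompose_stepanov_poly:
  "coeff (pcompose (stepanov_poly A N) [:b, 1:]) j =
    of_nat ((card A - 1 + N) choose j) *
      (\<Sum>a\<in>A. lagrange_weight A a * (a + b) ^ (card A - 1 + N - j)) - (if j = 0 then 1 else 0)"
proof -
  have *: "pcompose ([:a, 1:] ^ k) [:b, 1:] = [:a + b, 1:] ^ k" for a :: 'a and k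
    by (simp add: pcompose_power pcompose_pCons)
  show ?thesis
    by (simp add: stepanov_poly_def pcompose_diff pcompose_sum pcompose_smult pcompose_1 * coeff_sum
        coeff_monic_linear_power sum_distrib_left mult_ac)
qed

lemma coeff_stepanov_poly:
  assumes "finite A" and "A \<noteq> {}" and "N > 0" and "i \<ge> N"
  shows "coeff (stepanov_poly A N) i =
    (if i = N then of_nat ((card A - 1 + N) choose N) else 0)"
proof (cases "i \<le> card A - 1 + N")
  case True
  \<comment> \<open>The exponent of \<open>a\<close> in the coefficient at \<open>i\<close>: at most
    \<open>card A - 1\<close>, with equality only for \<open>i = N\<close>. The subtracted 1 affects
    only \<open>i = 0\<close>, excluded by \<open>N > 0\<close>.\<close>
  let ?k = "card A - 1 + N - i"
  have "card A > 0"
    using assms by (simp add: card_gt_0_iff)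
  then have "(\<Sum>a\<in>A. lagrange_weight A a * poly (monom 1 ?k) a) = coeff (monom 1 ?k) (card A - 1)"
    using assms by (intro sum_lagrange_weight) (auto simp: degree_monom_eq)
  then have "(\<Sum>a\<in>A. lagrange_weight A a * a ^ ?k) = (if i = N then 1 else 0)"
    using True assms by (auto simp: poly_monom split: if_splits)
  then show ?thesis
    using coeff_pcompose_stepanov_poly[of A N 0 i] assms by auto
next
  case False
  then show ?thesis
    using coeff_pcompose_stepanov_poly[of A N 0 i] assms by (simp add: binomial_eq_0)
qed

text \<open>Dropping \<open>N\<close> from the exponents turns the weighted sum into the coefficient
  at \<open>card A - 1\<close> of \<open>[:b, 1:] ^ (card A - 1 - j)\<close>. It is 0 for
  \<open>j > 0\<close>, and 1 for \<open>j = 0\<close>, where the subtracted 1 cancels it.\<close>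

lemma linear_power_dvd_stepanov_poly:
  assumes "finite A"
    and pow: "\<And>a. a \<in> A \<Longrightarrow> a + b \<noteq> 0 \<Longrightarrow> (a + b) ^ N = 1"
    and k: "k \<le> card A" "- b \<in> A \<Longrightarrow> k < card A"
  shows "[:- b, 1:] ^ k dvd stepanov_poly A N"
proof (rule linear_power_dvd_if_shifted_coeffs_0)
  fix j assume "j < k"
  with k have j: "j < card A" and j': "- b \<in> A \<Longrightarrow> j < card A - 1"
    by auto
  let ?e = "card A - 1 - j"
  have "(a + b) ^ (card A - 1 + N - j) = (a + b) ^ ?e" if "a \<in> A" for a
  proof (cases "a + b = 0")
    case True
    then have "- b \<in> A"
      using that by (simp add: eq_neg_iff_add_eq_0[symmetric])
    \<comment> \<open>Both sides are powers of 0; \<open>j < card A - 1\<close> makes both exponents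
      positive, avoiding \<open>0 ^ 0 = 1\<close>.\<close>
    then show ?thesis
      using True j' by (simp add: power_0_left)
  next
    case False
    have "card A - 1 + N - j = ?e + N"
      using j by simp
    then show ?thesis
      using pow[OF that False] by (simp add: power_add)
  qed
  then have "(\<Sum>a\<in>A. lagrange_weight A a * (a + b) ^ (card A - 1 + N - j)) =
      (\<Sum>a\<in>A. lagrange_weight A a * poly ([:b, 1:] ^ ?e) a)"
    by (simp add: add.commute)
  also have "\<dots> = coeff ([:b, 1:] ^ ?e) (card A - 1)"
    using assms(1) j by (intro sum_lagrange_weight) (auto simp: degree_linear_power)
  also have "\<dots> = (if j = 0 then 1 else 0)"
    using j by (auto simp: coeff_monic_linear_power binomial_eq_0)
  finally show "coeff (pcompose (stepanov_poly A N) [:b, 1:]) j = 0"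
    by (simp add: coeff_pcompose_stepanov_poly)
qed

section \<open>Counting roots with multiplicity\<close>

lemma card_mult_card_le_of_sums_roots_of_unity:
  fixes A B :: "'a::field set"
  assumes "finite A" and "finite B" and "N > 0"
    and pow: "\<And>a b. a \<in> A \<Longrightarrow> b \<in> B \<Longrightarrow> a + b \<noteq> 0 \<Longrightarrow> (a + b) ^ N = 1"
    and binom: "of_nat ((card A - 1 + N) choose N) \<noteq> (0::'a)"
  shows "card A * card B \<le> N + card (A \<inter> uminus ` B)"
proof (cases "A = {}")
  case False
  let ?f = "stepanov_poly A N"
  let ?C = "{b \<in> B. - b \<in> A}"
  \<comment> \<open>The binomial hypothesis keeps \<open>?f\<close> from vanishing identically, so
    its degree bounds the sum of orders.\<close>
  have "coeff ?f N \<noteq> 0"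
    using assms False by (simp add: coeff_stepanov_poly)
  then have nz: "?f \<noteq> 0"
    by auto
  have "card ?C = card (uminus ` ?C)"
    by (simp add: card_image)
  also have "uminus ` ?C = A \<inter> uminus ` B"
    by auto
  finally have C: "card ?C = card (A \<inter> uminus ` B)" .
  \<comment> \<open>The order lost when \<open>- b \<in> A\<close> adds up over \<open>B\<close> to
    \<open>card ?C\<close>.\<close>
  have order: "card A \<le> order b ?f + (if - b \<in> A then 1 else 0)" if "b \<in> B" for b
  proof -
    let ?k = "card A - (if - b \<in> A then 1 else 0)"
    have "card A > 0"
      using assms(1) False by (simp add: card_gt_0_iff)
    then have "[:- b, 1:] ^ ?k dvd ?f"
      using assms(1) pow[OF _ that] by (intro linear_power_dvd_stepanov_poly) auto
    then show ?thesis
      using nz by (auto simp: order_divides)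
  qed
  have "card A * card B = (\<Sum>b\<in>B. card A)"
    by simp
  also have "\<dots> \<le> (\<Sum>b\<in>B. order b ?f + (if - b \<in> A then 1 else 0))"
    by (intro sum_mono order)
  also have "\<dots> = (\<Sum>b\<in>B. order b ?f) + card ?C"
    using assms(2) by (simp add: sum.distrib sum.If_cases Int_def)
  also have "\<dots> \<le> degree ?f + card ?C"
    using nz assms(2) by (simp add: sum_order_on_le_degree)
  also have "degree ?f \<le> N"
    using assms False by (intro degree_le) (simp add: coeff_stepanov_poly)
  finally show ?thesis
    by (simp add: C)
qed simp

theorem theorem1p1:
  fixes A B :: "'a::{field, finite} set"
    and p q n d :: nat
  assumes "prime p" and "n > 0" and "q = p ^ n" and "CARD('a) = q"
    and "d dvd q - 1" and "d > 1"
    and "A + B \<subseteq> dth_powers d \<union> {0}"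
    and "\<not> [(card A + (q - 1) div d - 1) choose ((q - 1) div d) = 0] (mod p)"
  shows "card A * card B \<le> (q - 1) div d + card (A \<inter> uminus ` B)"
proof (cases "A = {}")
  case False
  let ?N = "(q - 1) div d"
  have dN: "d * ?N = CARD('a) - 1"
    using assms(4,5) by simp
  \<comment> \<open>Two distinct elements give \<open>q - 1 > 0\<close>, hence
    \<open>?N > 0\<close>.\<close>
  have "card {0, 1 :: 'a} \<le> CARD('a)"
    by (intro card_mono) auto
  then have "?N > 0"
    using dN by (cases "?N = 0") auto
  have pow: "(a + b) ^ ?N = 1" if "a \<in> A" "b \<in> B" "a + b \<noteq> 0" for a b
  proof -
    have "a + b \<in> dth_powers d"
      using assms(7) that by (auto dest: set_plus_intro)
    then obtain y where "a + b = y ^ d" "y \<noteq> 0"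
      by (auto simp: dth_powers_def)
    then show ?thesis
      using power_CARD_minus_1_eq_1[of y] dN by (metis power_mult)
  qed
  \<comment> \<open>With \<open>A\<close> nonempty, the truncated subtractions in the two binomials
    agree.\<close>
  have "card A > 0"
    using False by (simp add: card_gt_0_iff)
  then have "card A + ?N - 1 = card A - 1 + ?N"
    by simp
  moreover have "CHAR('a) = p"
    using assms(1,3,4) by (intro CHAR_eq_of_CARD_prime_power) auto
  ultimately have "of_nat ((card A - 1 + ?N) choose ?N) \<noteq> (0::'a)"
    using assms(8) by (simp add: of_nat_eq_0_iff_char_dvd cong_0_iff)
  then show ?thesis
    using \<open>?N > 0\<close> pow by (intro card_mult_card_le_of_sums_roots_of_unity) auto
qed simp

end
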